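(* The pricing problem for a cycle variable $x_c$ in the expanded line cycle of a given line $L$ in cXPESP is a set of $T$ shortest path problems in an acyclic graph.
   Context: **Event-activity network.** A line network is a finite undirected graph $G$ with a finite set $\mathcal L$ of lines, each line $L=(v_1,\dots,v_n)$ being a path in $G$ with at least one edge. The event-activity network $N$ is the directed graph whose nodes are called events and whose arcs are called activities. For each line $L=(v_1,\dots,v_n)$ and each $1\le i\le n-1$ it has events $(v_i,L,dep,+)$, $(v_{i+1},L,arr,+)$, $(v_{i+1},L,dep,-)$, $(v_i,L,arr,-)$ and driving activities $((v_i,L,dep,+),(v_{i+1},L,arr,+))$, $((v_{i+1},L,dep,-),(v_i,L,arr,-))$; for each stop $v$ of $L$ and $s\in\{+,-\}$ a waiting activity $((v,L,arr,s),(v,L,dep,s))$ if both events exist; turnaround activities $((v_1,L,arr,-),(v_1,L,dep,+))$ and $((v_n,L,arr,+),(v_n,L,dep,-))$; and for every ordered pair of distinct lines $L,L'$, every common stop $v$ and $s_1,s_2\in\{+,-\}$ a transfer activity $((v,L,arr,s_1),(v,L',dep,s_2))$ if both events exist. $V(N),A(N)$ are the sets of events and activities, $Z(N)$ is the set of transfer activities. The line cycle $\gamma_L$ is the directed cycle in $N$ formed by all events and all driving, waiting and turnaround activities of $L$. Given are a period $T\in\mathbb N$, bounds $l\le u$ in $\mathbb Z^{A(N)}$ and weights $\omega\in\mathbb Q^{A(N)}$. **Expanded network.** $[T]=\{0,\dots,T-1\}$, and $k \bmod T\in[T]$. $V(D)=\{v[t] : v\in V(N),t\in[T]\}$. For $\alpha=(v,w)\in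 A(N)$ let $\mathcal A(\alpha)=\{(v[t],w[t']) : t,t'\in[T],\ (t'-t-l_\alpha)\bmod T\le u_\alpha-l_\alpha\}$, and $A(D)=\bigcup_\alpha \mathcal A(\alpha)$. The duration of $a=(v[t],w[t'])\in\mathcal A(\alpha)$ is $\tau_a=((t'-t-l_\alpha)\bmod T)+l_\alpha$, its weight is $\omega_a=\omega_\alpha$. $Z(D)=\bigcup_{\alpha\in Z(N)}\mathcal A(\alpha)$. $\delta^{+}_{S}(v)$, $\delta^-_S(v)$ are the outgoing, respectively ingoing, arcs of $v$ in $S\subseteq A(D)$. The expanded line cycle of $L$ is $D$ restricted to the nodes $v[t]$ with $v\in V(\gamma_L)$, $t\in[T]$. A cycle of $L$ is a closed (directed, simple) path $c$ in the expanded line cycle with $|V(c)|=|V(\gamma_L)|$; $C_L$ is the set of cycles of $L$, $C=\bigcup_{L}C_L$, and $\vartheta_c=\sum_{a\in A(c)}\omega_a\tau_a$. **cXPESP and its dual.** The linear programming relaxation of cXPESP is: minimize $\sum_{c\in C}\vartheta_cx_c+\sum_{a\in Z(D)}\omega_a\tau_az_a$ over $x,z\ge0$ subject to $\sum_{c\in C_L}x_c=1$ for all $L\in\mathcal L$ (dual variable $\mu_L$), and for all $\alpha=(v,w)\in Z(N)$ and $t,t'\in[T]$: $\sum_{c\in C:v[t]\in c}x_c-\sum_{a\in\delta^+_{\mathcal A(\alpha)}(v[t])}z_a=0$ (dual variable $\nu_{v[t],w}$) and $\sum_{c\in C:w[t']\in c}x_c-\sum_{a\in\delta^-_{\mathcal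 A(\alpha)}(w[t'])}z_a=0$ (dual variable $\rho_{v,w[t']}$). The dual constraint belonging to a cycle variable $x_c$, $c\in C_L$, is $$\mu_L+\sum_{v[t]\in c}\ \sum_{y:(v,y)\in Z(N)}\nu_{v[t],y}+\sum_{w[t']\in c}\ \sum_{y:(y,w)\in Z(N)}\rho_{y,w[t']}\le\vartheta_c.$$ **Pricing problem.** The pricing problem for a cycle variable of line $L$ is, for given values of the dual variables, to find a cycle $c\in C_L$ violating this dual constraint, i.e. to solve $$\min_{c\in C_L}\ \vartheta_c-\sum_{v[t]\in c}\ \sum_{y:(v,y)\in Z(N)}\nu_{v[t],y}-\sum_{w[t']\in c}\ \sum_{y:(y,w)\in Z(N)}\rho_{y,w[t']}$$ and to check whether the optimal value is smaller than $\mu_L$. *)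

theory Defs
  imports Complex_Main "Graph_Theory.Graph_Theory"
begin

text \<open>A line is the list of the stops it visits; an event is a tuple (stop, line, arr/dep, direction).\<close>

datatype event_kind = Arr | Dep

datatype direction = Fwd | Bwd

type_synonym 'v line = "'v list"
type_synonym 'v event = "'v \<times> 'v line \<times> event_kind \<times> direction"
type_synonym 'v activity = "'v event \<times> 'v event"
type_synonym 'v xevent = "'v event \<times> nat"
type_synonym 'v xarc = "'v xevent \<times> 'v xevent"

text \<open>Undirected graphs are finite symmetric loop-free digraphs without parallel arcs.\<close>

definition line_network :: "'v pair_pre_digraph \<Rightarrow> 'v line set \<Rightarrow> bool" where
  "line_network G \<L> \<longleftrightarrow>
     pair_graph G \<and> finite \<L> \<and> (\<forall>L\<in>\<L>. vpath L (with_proj G) \<and> length L \<ge> 2)"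

definition line_events :: "'v line \<Rightarrow> 'v event set" where
  "line_events L = (\<Union>i\<in>{i. Suc i < length L}.
     {(L ! i, L, Dep, Fwd), (L ! Suc i, L, Arr, Fwd), (L ! Suc i, L, Dep, Bwd), (L ! i, L, Arr, Bwd)})"

definition driving_activities :: "'v line \<Rightarrow> 'v activity set" where
  "driving_activities L = (\<Union>i\<in>{i. Suc i < length L}.
     {((L ! i, L, Dep, Fwd), (L ! Suc i, L, Arr, Fwd)),
      ((L ! Suc i, L, Dep, Bwd), (L ! i, L, Arr, Bwd))})"

definition waiting_activities :: "'v line \<Rightarrow> 'v activity set" where
  "waiting_activities L = {((v, L, Arr, s), (v, L, Dep, s)) | v s.
     v \<in> set L \<and> (v, L, Arr, s) \<in> line_events L \<and> (v, L, Dep, s) \<in> line_events L}"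

definition turnaround_activities :: "'v line \<Rightarrow> 'v activity set" where
  "turnaround_activities L =
     {((hd L, L, Arr, Bwd), (hd L, L, Dep, Fwd)), ((last L, L, Arr, Fwd), (last L, L, Dep, Bwd))}"

definition transfer_activities :: "'v line set \<Rightarrow> 'v activity set" where
  "transfer_activities \<L> = {((v, L, Arr, s1), (v, L', Dep, s2)) | v L L' s1 s2.
     L \<in> \<L> \<and> L' \<in> \<L> \<and> L \<noteq> L' \<and> v \<in> set L \<and> v \<in> set L' \<and>
     (v, L, Arr, s1) \<in> line_events L \<and> (v, L', Dep, s2) \<in> line_events L'}"

definition line_cycle :: "'v line \<Rightarrow> 'v event pair_pre_digraph" where
  "line_cycle L = \<lparr> pverts = line_events L,
     parcs = driving_activities L \<union> waiting_activities L \<union> turnaround_activities L \<rparr>"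

definition event_network :: "'v line set \<Rightarrow> 'v event pair_pre_digraph" where
  "event_network \<L> = \<lparr> pverts = (\<Union>L\<in>\<L>. pverts (line_cycle L)),
     parcs = (\<Union>L\<in>\<L>. parcs (line_cycle L)) \<union> transfer_activities \<L> \<rparr>"

text \<open>The pair \<open>(v, t)\<close> stands for the expanded event \<open>v[t]\<close>.\<close>

definition expanded_arcs ::
  "nat \<Rightarrow> ('v activity \<Rightarrow> int) \<Rightarrow> ('v activity \<Rightarrow> int) \<Rightarrow> 'v activity \<Rightarrow> 'v xarc set" where
  "expanded_arcs T l u \<alpha> = {((fst \<alpha>, t), (snd \<alpha>, t')) | t t'.
     t < T \<and> t' < T \<and> (int t' - int t - l \<alpha>) mod int T \<le> u \<alpha> - l \<alpha>}"

definition expanded_network ::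
  "'v line set \<Rightarrow> nat \<Rightarrow> ('v activity \<Rightarrow> int) \<Rightarrow> ('v activity \<Rightarrow> int) \<Rightarrow> 'v xevent pair_pre_digraph" where
  "expanded_network \<L> T l u = \<lparr> pverts = pverts (event_network \<L>) \<times> {..<T},
     parcs = (\<Union>\<alpha>\<in>parcs (event_network \<L>). expanded_arcs T l u \<alpha>) \<rparr>"

text \<open>An activity is determined by its two events, so an expanded arc determines its activity.\<close>

definition activity_of :: "'v xarc \<Rightarrow> 'v activity" where
  "activity_of a = (fst (fst a), fst (snd a))"

definition duration :: "nat \<Rightarrow> ('v activity \<Rightarrow> int) \<Rightarrow> 'v xarc \<Rightarrow> int" where
  "duration T l a =
     (int (snd (snd a)) - int (snd (fst a)) - l (activity_of a)) mod int T + l (activity_of a)"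

definition expanded_line_cycle ::
  "'v line set \<Rightarrow> nat \<Rightarrow> ('v activity \<Rightarrow> int) \<Rightarrow> ('v activity \<Rightarrow> int) \<Rightarrow> 'v line
   \<Rightarrow> ('v xevent, 'v xarc) pre_digraph" where
  "expanded_line_cycle \<L> T l u L =
     with_proj (expanded_network \<L> T l u) \<restriction> (pverts (line_cycle L) \<times> {..<T})"

text \<open>
  A closed path has no distinguished starting node, so it is represented by its set of arcs
  rather than by an arc list, which would yield one variable per rotation.
\<close>

definition cycle_verts :: "'v xarc set \<Rightarrow> 'v xevent set" where
  "cycle_verts c = fst ` c \<union> snd ` c"

definition cycles_of_line ::
  "'v line set \<Rightarrow> nat \<Rightarrow> ('v activity \<Rightarrow> int) \<Rightarrow> ('v activity \<Rightarrow> int) \<Rightarrow> 'v line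
   \<Rightarrow> 'v xarc set set" where
  "cycles_of_line \<L> T l u L = {c. \<exists>p. pre_digraph.cycle (expanded_line_cycle \<L> T l u L) p \<and>
     c = set p \<and> card (cycle_verts c) = card (pverts (line_cycle L))}"

definition cycle_cost ::
  "nat \<Rightarrow> ('v activity \<Rightarrow> int) \<Rightarrow> ('v activity \<Rightarrow> rat) \<Rightarrow> 'v xarc set \<Rightarrow> real" where
  "cycle_cost T l \<omega> c =
     (\<Sum>a\<in>c. real_of_rat (\<omega> (activity_of a)) * real_of_int (duration T l a))"

text \<open>The dual values are \<open>\<nu> v[t] w\<close> and \<open>\<rho> v w[t']\<close> for transfer activities \<open>(v, w)\<close>.\<close>

definition coupling_dual_sum ::
  "'v line set \<Rightarrow> ('v xevent \<Rightarrow> 'v event \<Rightarrow> real) \<Rightarrow> ('v event \<Rightarrow> 'v xevent \<Rightarrow> real)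
   \<Rightarrow> 'v xarc set \<Rightarrow> real" where
  "coupling_dual_sum \<L> \<nu> \<rho> c =
     (\<Sum>x\<in>cycle_verts c. \<Sum>y\<in>{y. (fst x, y) \<in> transfer_activities \<L>}. \<nu> x y) +
     (\<Sum>x\<in>cycle_verts c. \<Sum>y\<in>{y. (y, fst x) \<in> transfer_activities \<L>}. \<rho> y x)"

definition dual_constraint ::
  "'v line set \<Rightarrow> nat \<Rightarrow> ('v activity \<Rightarrow> int) \<Rightarrow> ('v activity \<Rightarrow> rat)
   \<Rightarrow> ('v line \<Rightarrow> real) \<Rightarrow> ('v xevent \<Rightarrow> 'v event \<Rightarrow> real) \<Rightarrow> ('v event \<Rightarrow> 'v xevent \<Rightarrow> real)
   \<Rightarrow> 'v line \<Rightarrow> 'v xarc set \<Rightarrow> bool" where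
  "dual_constraint \<L> T l \<omega> \<mu> \<nu> \<rho> L c \<longleftrightarrow> \<mu> L + coupling_dual_sum \<L> \<nu> \<rho> c \<le> cycle_cost T l \<omega> c"

definition pricing_objective ::
  "'v line set \<Rightarrow> nat \<Rightarrow> ('v activity \<Rightarrow> int) \<Rightarrow> ('v activity \<Rightarrow> rat)
   \<Rightarrow> ('v xevent \<Rightarrow> 'v event \<Rightarrow> real) \<Rightarrow> ('v event \<Rightarrow> 'v xevent \<Rightarrow> real)
   \<Rightarrow> 'v xarc set \<Rightarrow> real" where
  "pricing_objective \<L> T l \<omega> \<nu> \<rho> c = cycle_cost T l \<omega> c - coupling_dual_sum \<L> \<nu> \<rho> c"

text \<open>
  A graph obtained from \<open>X\<close> by splitting nodes into at most two copies \<open>(x, False)\<close> and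
  \<open>(x, True)\<close>, where every arc of \<open>X\<close> is kept exactly once, attached to some copies of its ends.
\<close>

definition node_splitting ::
  "('x, 'x \<times> 'x) pre_digraph \<Rightarrow> ('x \<times> bool) pair_pre_digraph \<Rightarrow> bool" where
  "node_splitting X H \<longleftrightarrow> fst ` pverts H = verts X \<and>
     bij_betw (map_prod fst fst) (parcs H) (arcs X)"

definition unsplit_path :: "(('x \<times> bool) \<times> ('x \<times> bool)) list \<Rightarrow> ('x \<times> 'x) set" where
  "unsplit_path p = map_prod fst fst ` set p"

end

theory Submission
  imports Defs
begin

text \<open>
  The position along the line cycle, modulo its length \<open>m\<close>, is a cyclic layering of the expanded
  line cycle: every arc leads to the next layer. Hence a simple closed path with \<open>m\<close> nodes winds
  around exactly once and meets the layer of the first departure event exactly once. Cutting the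
  nodes \<open>v[t]\<close> of this layer into a source copy, which keeps the outgoing arcs, and a target copy,
  which keeps the incoming ones, leaves an acyclic graph, and the cycles through \<open>v[t]\<close> become
  the paths from the source copy to the target copy of \<open>v[t]\<close>, one shortest path problem per \<open>t\<close>.
\<close>

section \<open>Tails and heads along a simple closed walk\<close>

text \<open>A closed walk from \<open>u\<close> lists the same nodes as its tails followed by
  \<open>u\<close> and as \<open>u\<close> followed by its heads, so tails and heads agree as
  multisets; \<open>cycle\<close> itself makes the heads distinct.\<close>

lemma (in pair_wf_digraph) cycle_tails_heads:
  assumes "cycle p"
  shows "distinct (map fst p)" "fst ` set p = snd ` set p"
proof -
  from assms obtain u where u: "awalk u p u" "distinct (tl (pawalk_verts u p))" "p \<noteq> []"
    unfolding cycle_def by blast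
  have cas: "pcas u p u" using u(1) by (simp add: awalk_def)
  have heads: "pawalk_verts u p = fst (hd p) # map snd p"
    using awalk_verts_conv'[OF cas] u(3) by simp
  have "fst (hd p) = u" using cas u(3) by (cases p) auto
  moreover have "snd (last p) = u"
    using awlast_of_awalk[OF u(1)] u(3) by (simp add: awalk_verts_conv)
  ultimately have "map fst p @ [u] = u # map snd p"
    using heads awalk_verts_conv[of u p] u(3) by simp
  then have "mset (map fst p @ [u]) = mset (u # map snd p)" by (rule arg_cong)
  then have mset: "mset (map fst p) = mset (map snd p)" by simp
  moreover have "distinct (map snd p)" using u(2) heads by simp
  ultimately show "distinct (map fst p)" using mset_eq_imp_distinct_iff by blast
  show "fst ` set p = snd ` set p" using mset_eq_setD[OF mset] by simp
qed

text \<open>Turns the node count in \<open>cycles_of_line\<close> into a condition on the length of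
  the arc list.\<close>

lemma (in pair_wf_digraph) card_cycle_verts:
  assumes "cycle p"
  shows "card (fst ` set p \<union> snd ` set p) = length p"
proof -
  have "card (fst ` set p) = length p"
    using distinct_card[OF cycle_tails_heads(1)[OF assms]] by simp
  then show ?thesis using cycle_tails_heads(2)[OF assms] by simp
qed

section \<open>Cutting a cyclically layered graph open at layer 0\<close>

text \<open>Separates the graph theory from the timetable: later \<open>X\<close> is the expanded
  line cycle, \<open>layer\<close> the position of the event and \<open>m\<close> the number of
  events of the line.\<close>

locale cyclic_layering =
  fixes X :: "'a pair_pre_digraph" and layer :: "'a \<Rightarrow> nat" and m :: nat
  assumes finite_verts: "finite (pverts X)"
    and arcs_wf: "parcs X \<subseteq> pverts X \<times> pverts X"
    and layer_less: "v \<in> pverts X \<Longrightarrow> layer v < m"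
    and layer_arc: "(v, w) \<in> parcs X \<Longrightarrow> layer w = Suc (layer v) mod m"
begin

text \<open>\<open>True\<close> marks the target copy of a node of layer 0; \<open>False\<close>
  marks its source copy and the only copy of any other node.\<close>

definition lift_arc :: "'a \<times> 'a \<Rightarrow> ('a \<times> bool) \<times> ('a \<times> bool)" where
  "lift_arc e = ((fst e, False), (snd e, layer (snd e) = 0))"

definition cut :: "('a \<times> bool) pair_pre_digraph" where
  "cut = \<lparr> pverts = pverts X \<times> {False} \<union> {v \<in> pverts X. layer v = 0} \<times> {True},
     parcs = lift_arc ` parcs X \<rparr>"

text \<open>The layer without wrap-around: a target copy ends a full turn, so its rank is
  \<open>m\<close> instead of 0.\<close>

definition rank :: "'a \<times> bool \<Rightarrow> nat" where
  "rank x = (if snd x then m else layer (fst x))"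

lemma unlift_lift [simp]: "map_prod fst fst (lift_arc e) = e"
  by (simp add: lift_arc_def)

lemma lift_unlift: "e \<in> parcs cut \<Longrightarrow> lift_arc (map_prod fst fst e) = e"
  by (auto simp: cut_def)

lemma unlift_arc: "e \<in> parcs cut \<Longrightarrow> map_prod fst fst e \<in> parcs X"
  by (auto simp: cut_def)

lemma fst_verts_cut: "x \<in> pverts cut \<Longrightarrow> fst x \<in> pverts X"
  by (auto simp: cut_def)

lemma inj_on_unlift: "inj_on (map_prod fst fst) (parcs cut)"
  by (rule inj_on_inverseI) (rule lift_unlift)

sublocale X: pair_fin_digraph X
  using arcs_wf finite_verts finite_subset[OF arcs_wf]
  by unfold_locales auto

sublocale H: pair_fin_digraph cut
proof
  show "finite (pverts cut)" "finite (parcs cut)"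
    using X.pair_finite_verts X.pair_finite_arcs by (auto simp: cut_def)
qed (use arcs_wf in \<open>auto simp: cut_def lift_arc_def\<close>)

lemma node_splitting_cut: "node_splitting (with_proj X) cut"
proof -
  have "bij_betw (map_prod fst fst) (parcs cut) (parcs X)"
    using inj_on_unlift by (auto simp: bij_betw_def cut_def image_image)
  moreover have "fst ` pverts cut = pverts X" by (force simp: cut_def)
  ultimately show ?thesis by (simp add: node_splitting_def)
qed

lemma rank_arc:
  assumes "e \<in> parcs cut"
  shows "rank (snd e) = Suc (rank (fst e))"
proof -
  obtain v w where vw: "(v, w) \<in> parcs X" "e = lift_arc (v, w)"
    using assms by (auto simp: cut_def)
  then have "layer v < m" "layer w = Suc (layer v) mod m"
    using arcs_wf layer_less layer_arc by auto
  \<comment> \<open>Only arcs leaving layer \<open>m - 1\<close> wrap around; they enter layer 0,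
    where the lifted head has rank \<open>m\<close>.\<close>
  then show ?thesis
    using vw by (cases "Suc (layer v) = m") (auto simp: lift_arc_def rank_def)
qed

lemma acyclic_cut: "acyclic (parcs cut)"
proof (rule acyclic_subset)
  show "acyclic (measure rank)" by (simp add: wf_acyclic)
  show "parcs cut \<subseteq> measure rank" using rank_arc by fastforce
qed

section \<open>Walks in the cut graph and their projections\<close>

text \<open>Each arc raises the rank by one. The three forms serve to fix the length of a walk, the
  distinctness of its nodes, and the order of its arcs when only their set is known.\<close>

lemma awalk_cut_ranks:
  assumes "H.awalk x p y"
  shows "rank y = rank x + length p"
    and "map rank (pawalk_verts x p) = [rank x..<Suc (rank y)]"
    and "map (rank \<circ> fst) p = [rank x..<rank y]"
  using assms
proof (induction p arbitrary: x)
  case Nil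
  { case 1 then show ?case by (simp add: H.awalk_Nil_iff) }
  { case 2 then show ?case by (simp add: H.awalk_Nil_iff) }
  { case 3 then show ?case by (simp add: H.awalk_Nil_iff) }
next
  case (Cons e p)
  have step: "rank (snd e) = Suc (rank x)" "H.awalk (snd e) p y" "x = fst e"
    if "H.awalk x (e # p) y" for x using that rank_arc by (auto simp: H.awalk_Cons_iff)
  { case 1 then show ?case using step[OF 1] Cons.IH(1)[of "snd e"] by simp }
  { case 2
    then show ?case using step[OF 2] Cons.IH(1,2)[of "snd e"]
      by (simp add: upt_conv_Cons del: upt_Suc) }
  { case 3
    then show ?case using step[OF 3] Cons.IH(1,3)[of "snd e"]
      by (simp add: upt_conv_Cons del: upt_Suc) }
qed

lemma apath_cut_iff_awalk: "H.apath x p y \<longleftrightarrow> H.awalk x p y"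
proof -
  have "distinct (pawalk_verts x p)" if "H.awalk x p y"
    using awalk_cut_ranks(2)[OF that] by (metis distinct_map distinct_upt)
  then show ?thesis by (auto simp: H.apath_def)
qed

lemma awalk_unlift:
  "H.awalk x p y \<Longrightarrow> X.awalk (fst x) (map (map_prod fst fst) p) (fst y)"
proof (induction p arbitrary: x)
  case Nil
  then show ?case by (auto simp: H.awalk_Nil_iff X.awalk_Nil_iff fst_verts_cut)
next
  case (Cons e p)
  then show ?case by (auto simp: H.awalk_Cons_iff X.awalk_Cons_iff unlift_arc)
qed

text \<open>The length bound lets the walk enter layer 0 only with its last arc; a lifted walk could
  not continue from a target copy. An empty walk at layer 0 would have to join a source copy to a
  target copy.\<close>

lemma awalk_lift:
  assumes "X.awalk v p w" "p \<noteq> []" "layer v + length p \<le> m"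
  shows "H.awalk (v, False) (map lift_arc p) (w, layer w = 0)"
  using assms
proof (induction p arbitrary: v)
  case (Cons e p)
  then have e: "e \<in> parcs X" "v = fst e" "X.awalk (snd e) p w"
    by (auto simp: X.awalk_Cons_iff)
  have *: "H.awalk (snd e, layer (snd e) = 0) (map lift_arc p) (w, layer w = 0)"
  proof (cases "p = []")
    case True
    moreover have "(w, layer w = 0) \<in> pverts cut"
      using Cons.prems(1) X.awalk_last_in_verts by (auto simp: cut_def)
    ultimately show ?thesis using e by (simp add: X.awalk_Nil_iff H.awalk_Nil_iff)
  next
    case False
    \<comment> \<open>With \<open>e\<close> there are at least two arcs, so the head of
      \<open>e\<close> is not in layer 0 and the induction hypothesis applies to its
      \<open>False\<close> copy.\<close>
    then have "Suc (layer v) < m" using Cons.prems by (cases p) auto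
    then have "layer (snd e) = Suc (layer v)"
      using e layer_arc[of v "snd e"] by simp
    with False Cons e show ?thesis by simp
  qed
  have "lift_arc e \<in> parcs cut" using e by (simp add: cut_def)
  with * e show ?case by (simp add: H.awalk_Cons_iff) (simp add: lift_arc_def)
qed simp

lemma awalk_layer: "X.awalk v p w \<Longrightarrow> layer w = (layer v + length p) mod m"
proof (induction p arbitrary: v)
  case Nil
  then show ?case using layer_less by (auto simp: X.awalk_Nil_iff)
next
  case (Cons e p)
  then have "X.awalk (snd e) p w" "layer (snd e) = Suc (layer v) mod m"
    using layer_arc[of v "snd e"] by (auto simp: X.awalk_Cons_iff)
  then show ?case using Cons.IH by (simp add: mod_simps)
qed

section \<open>Paths in the cut graph and cycles that wind around once\<close>

text \<open>By \<open>awalk_layer\<close> the length of a closed walk is a multiple of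
  \<open>m\<close>; length \<open>m\<close> means a single turn.\<close>

definition winding_once :: "('a \<times> 'a) set set" where
  "winding_once = {c. \<exists>p. X.cycle p \<and> c = set p \<and> length p = m}"

text \<open>The rank climbs from 0 to \<open>m\<close>, so the heads have ranks 1 to
  \<open>m\<close> and lie in distinct layers. Hence merging copies identifies only the two ends of
  the path.\<close>

lemma apath_cut_imp_cycle:
  assumes "H.apath (s, False) p (s, True)"
  shows "X.cycle (map (map_prod fst fst) p)" "layer s = 0" "length p = m" "p \<noteq> []"
proof -
  have walk: "H.awalk (s, False) p (s, True)" using assms by (simp add: H.apath_def)
  then have "(s, True) \<in> pverts cut" by (rule H.awalk_last_in_verts)
  then show s: "layer s = 0" by (auto simp: cut_def)
  then show len: "length p = m" using awalk_cut_ranks(1)[OF walk] by (simp add: rank_def)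
  show ne: "p \<noteq> []" using walk by (auto simp: H.awalk_Nil_iff)
  let ?p = "map (map_prod fst fst) p"
  have walkX: "X.awalk s ?p s" using awalk_unlift[OF walk] by simp
  have ranks: "map rank (pawalk_verts (s, False) p) = [0..<Suc m]"
    using awalk_cut_ranks(2)[OF walk] s by (simp add: rank_def)
  have heads: "pawalk_verts (s, False) p = (s, False) # map snd p"
    using H.awalk_verts_conv'[of "(s, False)" p "(s, True)"] walk ne
    by (cases p) (auto simp: H.awalk_def)
  have "map (rank \<circ> snd) p = tl [0..<Suc m]"
    using arg_cong[OF ranks, of tl] unfolding heads by simp
  also have "\<dots> = [1..<Suc m]" by (simp add: upt_conv_Cons del: upt_Suc)
  finally have ranks': "map (rank \<circ> snd) p = [1..<Suc m]" .
  have "layer (fst x) = rank x mod m" if "x \<in> snd ` set p" for x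
  proof -
    have "set p \<subseteq> parcs cut" using walk by (simp add: H.awalk_def)
    with that obtain e where "e \<in> parcs cut" "x = snd e" by blast
    then show ?thesis using layer_less arcs_wf by (auto simp: cut_def lift_arc_def rank_def)
  qed
  then have "map (layer \<circ> fst \<circ> snd) p = map (\<lambda>i. i mod m) (map (rank \<circ> snd) p)" by simp
  \<comment> \<open>0 and \<open>m\<close> have the same residue, so the interval starts at 1:
    \<open>cycle\<close> asks for distinct nodes only after the first one.\<close>
  moreover have "inj_on (\<lambda>i. i mod m) {1..<Suc m}"
  proof (rule inj_onI)
    fix i j assume "i \<in> {1..<Suc m}" "j \<in> {1..<Suc m}" "i mod m = j mod m"
    then show "i = j" by (cases "i = m"; cases "j = m") auto
  qed
  ultimately have "distinct (map (layer \<circ> fst \<circ> snd) p)"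
    unfolding ranks' by (simp add: distinct_map del: upt_Suc)
  then have "distinct (map (fst \<circ> snd) p)"
    by (metis distinct_map map_map comp_assoc)
  moreover have "tl (pawalk_verts s ?p) = map (fst \<circ> snd) p"
    using X.awalk_verts_conv'[of s ?p s] walkX ne by (auto simp: X.awalk_def)
  ultimately show "X.cycle ?p"
    using walkX ne unfolding X.cycle_def by (intro exI[of _ s]) auto
qed

text \<open>Every closed walk of length \<open>m\<close> meets layer \<open>0\<close>; rotating it to start there makes it liftable.\<close>

lemma winding_once_imp_apath_cut:
  assumes "c \<in> winding_once"
  obtains s p where "s \<in> pverts X" "layer s = 0" "H.apath (s, False) p (s, True)"
    "map_prod fst fst ` set p = c"
proof -
  obtain p u where p: "c = set p" "length p = m" "p \<noteq> []" and walk: "X.awalk u p u"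
    using assms by (auto simp: winding_once_def X.cycle_def)
  \<comment> \<open>From \<open>u\<close>, \<open>m - layer u\<close> arcs lead to layer 0. If
    \<open>u\<close> lies there already, this is the full turn and \<open>s\<close> is
    \<open>u\<close>.\<close>
  define j s where "j = m - layer u" and "s = last (pawalk_verts u (take j p))"
  have "X.awalk u (take j p @ drop j p) u" using walk by simp
  then have parts: "X.awalk u (take j p) s" "X.awalk s (drop j p) u"
    unfolding X.awalk_append_iff s_def by auto
  have "layer u < m" using walk layer_less X.awalk_hd_in_verts by blast
  then have s: "layer s = 0"
    using awalk_layer[OF parts(1)] p by (simp add: j_def)
  let ?p = "drop j p @ take j p"
  have "X.awalk s ?p s" using X.awalk_appendI[OF parts(2,1)] .
  moreover have "length ?p = m" "?p \<noteq> []" using p \<open>layer u < m\<close> by (auto simp: j_def)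
  ultimately have "H.awalk (s, False) (map lift_arc ?p) (s, layer s = 0)"
    using s by (intro awalk_lift) auto
  then have "H.apath (s, False) (map lift_arc ?p) (s, True)"
    using s by (simp add: apath_cut_iff_awalk)
  moreover have "map_prod fst fst ` set (map lift_arc ?p) = c"
  proof -
    have "set ?p = c" using p by (metis append_take_drop_id set_append Un_commute)
    then show ?thesis by (simp add: image_image image_Un)
  qed
  moreover have "s \<in> pverts X" using parts(2) X.awalk_hd_in_verts by blast
  ultimately show thesis using s that by blast
qed

text \<open>Unlifting is injective on arcs, so both paths have the same lifted arcs; the ranks of
  the tails, 0 to \<open>m - 1\<close>, force their order, and the first tail gives
  \<open>s\<close>.\<close>

lemma apath_cut_inj:
  assumes "H.apath (s, False) p (s, True)" "H.apath (s', False) p' (s', True)"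
    and "map_prod fst fst ` set p = map_prod fst fst ` set p'"
  shows "s = s' \<and> p = p'"
proof -
  note walks = assms(1,2)[unfolded apath_cut_iff_awalk]
  have "set p \<subseteq> parcs cut" "set p' \<subseteq> parcs cut" using walks by (auto simp: H.awalk_def)
  then have sets: "set p = set p'"
    using assms(3) inj_on_unlift by (metis inj_on_image_eq_iff)
  have ranks: "map (rank \<circ> fst) p = [0..<m]" "map (rank \<circ> fst) p' = [0..<m]"
    using walks[THEN awalk_cut_ranks(3)] assms(1,2)[THEN apath_cut_imp_cycle(2)]
    by (simp_all add: rank_def)
  then have "inj_on (rank \<circ> fst) (set p)" by (metis distinct_map distinct_upt)
  then have "p = p'" using ranks sets by (metis map_inj_on sup.idem)
  moreover have "fst (hd p) = (s, False)" "fst (hd p') = (s', False)"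
    using walks assms(1,2)[THEN apath_cut_imp_cycle(4)]
    by (cases p; cases p'; auto simp: H.awalk_Cons_iff)+
  ultimately show ?thesis by simp
qed

text \<open>\<open>\<sigma>\<close> will enumerate the expanded first departures by their time
  \<open>t\<close>. A cycle belongs to the one \<open>t\<close> whose node it meets in layer
  0.\<close>

lemma bij_betw_apaths_winding_once:
  assumes "bij_betw \<sigma> I {v \<in> pverts X. layer v = 0}"
  shows "bij_betw (\<lambda>(t, p). map_prod fst fst ` set p)
    (SIGMA t:I. {p. H.apath (\<sigma> t, False) p (\<sigma> t, True)}) winding_once"
proof (rule bij_betwI', safe)
  fix t p t' p'
  assume *: "t \<in> I" "t' \<in> I" "H.apath (\<sigma> t, False) p (\<sigma> t, True)"
    "H.apath (\<sigma> t', False) p' (\<sigma> t', True)"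
    and eq: "map_prod fst fst ` set p = map_prod fst fst ` set p'"
  have "\<sigma> t = \<sigma> t' \<and> p = p'" using apath_cut_inj[OF *(3,4) eq] .
  then show "t = t'" "p = p'"
    using assms * by (auto simp: bij_betw_def inj_on_def)
next
  fix t p assume "H.apath (\<sigma> t, False) p (\<sigma> t, True)"
  from apath_cut_imp_cycle[OF this]
  show "map_prod fst fst ` set p \<in> winding_once"
    unfolding winding_once_def by (intro CollectI exI[of _ "map (map_prod fst fst) p"]) simp
next
  fix c assume "c \<in> winding_once"
  then obtain s p where sp: "s \<in> pverts X" "layer s = 0" "H.apath (s, False) p (s, True)"
    "map_prod fst fst ` set p = c" by (rule winding_once_imp_apath_cut)
  then have "s \<in> \<sigma> ` I" using assms by (simp add: bij_betw_def)
  then obtain t where "t \<in> I" "\<sigma> t = s" by blast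
  with sp show "\<exists>x\<in>SIGMA t:I. {p. H.apath (\<sigma> t, False) p (\<sigma> t, True)}.
      c = (case x of (t, p) \<Rightarrow> map_prod fst fst ` set p)"
    by (intro bexI[of _ "(t, p)"]) auto
qed

section \<open>Path costs and distances in the cut graph\<close>

text \<open>A node weight is moved to the unique arc of the cycle that leaves the node.\<close>

lemma awalk_cost_cut:
  fixes f :: "'a \<times> 'a \<Rightarrow> real" and h :: "'a \<Rightarrow> real"
  assumes path: "H.apath (s, False) p (s, True)" and c: "c = map_prod fst fst ` set p"
  shows "H.awalk_cost (\<lambda>e. f (map_prod fst fst e) - h (fst (fst e))) p
    = (\<Sum>e\<in>c. f e) - (\<Sum>v\<in>fst ` c \<union> snd ` c. h v)"
proof -
  let ?p = "map (map_prod fst fst) p"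
  have cyc: "X.cycle ?p" using apath_cut_imp_cycle[OF path] by blast
  have dist: "distinct (map fst ?p)" and heads: "fst ` c = snd ` c"
    using X.cycle_tails_heads[OF cyc] by (simp_all add: c)
  have c': "c = set ?p" by (simp add: c)
  have "distinct ?p" "inj_on fst c" using dist unfolding c' distinct_map by auto
  have "H.awalk_cost (\<lambda>e. f (map_prod fst fst e) - h (fst (fst e))) p
      = (\<Sum>e\<leftarrow>?p. f e - h (fst e))"
    by (simp add: H.awalk_cost_def comp_def)
  also have "\<dots> = (\<Sum>e\<in>c. f e - h (fst e))"
    unfolding c' using \<open>distinct ?p\<close> by (rule sum_list_distinct_conv_sum_set)
  also have "\<dots> = (\<Sum>e\<in>c. f e) - (\<Sum>v\<in>fst ` c. h v)"
    using \<open>inj_on fst c\<close> by (simp add: sum_subtractf sum.reindex)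
  finally show ?thesis using heads by simp
qed

text \<open>\<open>H.\<mu>\<close> is an infimum over walks; in the cut graph these are the paths,
  whatever the sign of the weights.\<close>

lemma \<mu>_cut_eq: "H.\<mu> w x y = (INF p\<in>{p. H.apath x p y}. ereal (H.awalk_cost w p))"
  by (simp add: H.\<mu>_def apath_cut_iff_awalk)

end

section \<open>Positions of events along a line cycle\<close>

definition stop_index :: "'v line \<Rightarrow> 'v \<Rightarrow> nat" where
  "stop_index L = the_inv_into {..<length L} ((!) L)"

lemma stop_index_nth:
  assumes "distinct L" "i < length L"
  shows "stop_index L (L ! i) = i"
  unfolding stop_index_def using assms by (intro the_inv_into_f_f inj_on_nth) auto

text \<open>Positions count from the first departure of the line; the backward run starts at
  position \<open>2 * (length L - 1)\<close>. The truncated \<open>0 - 1\<close> in the second equation is harmless, as no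
  forward arrival exists at the first stop.\<close>

fun event_pos :: "'v line \<Rightarrow> 'v event \<Rightarrow> nat" where
  "event_pos L (v, _, Dep, Fwd) = 2 * stop_index L v"
| "event_pos L (v, _, Arr, Fwd) = 2 * stop_index L v - 1"
| "event_pos L (v, _, Dep, Bwd) = 4 * (length L - 1) - 2 * stop_index L v"
| "event_pos L (v, _, Arr, Bwd) = 4 * (length L - 1) - 2 * stop_index L v - 1"

context
  fixes L :: "'v line"
  assumes dist: "distinct L" and two_stops: "length L \<ge> 2"
begin

lemma nonempty: "L \<noteq> []"
  using two_stops by auto

lemma hd_last_nth: "hd L = L ! 0" "last L = L ! (length L - 1)"
  using nonempty by (rule hd_conv_nth, rule last_conv_nth)

lemma event_pos_nth:
  "i < length L \<Longrightarrow> event_pos L (L ! i, M, Dep, Fwd) = 2 * i"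
  "i < length L \<Longrightarrow> event_pos L (L ! i, M, Arr, Fwd) = 2 * i - 1"
  "i < length L \<Longrightarrow> event_pos L (L ! i, M, Dep, Bwd) = 4 * (length L - 1) - 2 * i"
  "i < length L \<Longrightarrow> event_pos L (L ! i, M, Arr, Bwd) = 4 * (length L - 1) - 2 * i - 1"
  using dist by (simp_all add: stop_index_nth)

lemma line_event_cases:
  assumes "e \<in> line_events L"
  obtains i where "Suc i < length L" "e = (L ! i, L, Dep, Fwd)"
  | i where "Suc i < length L" "e = (L ! Suc i, L, Arr, Fwd)"
  | i where "Suc i < length L" "e = (L ! Suc i, L, Dep, Bwd)"
  | i where "Suc i < length L" "e = (L ! i, L, Arr, Bwd)"
  using assms unfolding line_events_def by blast

lemma event_pos_less: "e \<in> line_events L \<Longrightarrow> event_pos L e < 4 * (length L - 1)"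
  by (erule line_event_cases) (auto simp: event_pos_nth simp del: event_pos.simps)

text \<open>Layer 0 thus consists of the copies of a single event, one per time point, which is why
  there are exactly \<open>T\<close> problems.\<close>

lemma event_pos_eq_0:
  "e \<in> line_events L \<Longrightarrow> event_pos L e = 0 \<longleftrightarrow> e = (hd L, L, Dep, Fwd)"
  using dist nonempty unfolding hd_last_nth
  by (auto elim!: line_event_cases
      simp: event_pos_nth nth_eq_iff_index_eq simp del: event_pos.simps)

lemma first_event_in: "(hd L, L, Dep, Fwd) \<in> line_events L"
  using two_stops unfolding line_events_def hd_last_nth by (auto intro!: exI[of _ 0])

text \<open>Each edge of the line contributes four events, told apart by kind and direction; across
  edges the distinct stops tell them apart.\<close>

lemma card_line_events: "card (line_events L) = 4 * (length L - 1)"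
proof -
  let ?I = "{..<length L - 1}"
  let ?f = "\<lambda>i. (L ! i, L, Dep, Fwd)" and ?g = "\<lambda>i. (L ! Suc i, L, Arr, Fwd)"
  let ?h = "\<lambda>i. (L ! Suc i, L, Dep, Bwd)" and ?k = "\<lambda>i. (L ! i, L, Arr, Bwd)"
  have "line_events L = (?f ` ?I \<union> ?g ` ?I) \<union> (?h ` ?I \<union> ?k ` ?I)"
    unfolding line_events_def by (auto simp: less_diff_conv)
  moreover have "inj_on ?f ?I" "inj_on ?g ?I" "inj_on ?h ?I" "inj_on ?k ?I"
    using dist by (auto simp: inj_on_def nth_eq_iff_index_eq)
  then have "card (?f ` ?I) = length L - 1" "card (?g ` ?I) = length L - 1"
    "card (?h ` ?I) = length L - 1" "card (?k ` ?I) = length L - 1"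
    by (simp_all only: card_image card_lessThan)
  ultimately show ?thesis
    by (simp only:) (subst card_Un_disjoint; auto)+
qed

lemma line_cycle_activity_ends:
  assumes "(e, f) \<in> parcs (line_cycle L)"
  shows "e \<in> line_events L" "f \<in> line_events L"
proof -
  have "{(L ! 0, L, Arr, Bwd), (L ! 0, L, Dep, Fwd)} \<subseteq> line_events L"
    using two_stops unfolding line_events_def by (auto intro!: exI[of _ 0])
  moreover have "{(L ! (length L - 1), L, Arr, Fwd), (L ! (length L - 1), L, Dep, Bwd)}
      \<subseteq> line_events L"
  proof -
    \<comment> \<open>The last stop is the later end of the edge with index
      \<open>length L - 2\<close>, the form in which \<open>line_events\<close> contains it.\<close>
    have eq: "length L - 1 = Suc (length L - 2)" and "Suc (length L - 2) < length L"
      using two_stops by simp_all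
    then show ?thesis unfolding line_events_def eq by blast
  qed
  moreover have "driving_activities L \<subseteq> line_events L \<times> line_events L"
    unfolding driving_activities_def line_events_def by blast
  moreover have "waiting_activities L \<subseteq> line_events L \<times> line_events L"
    unfolding waiting_activities_def by blast
  ultimately have "parcs (line_cycle L) \<subseteq> line_events L \<times> line_events L"
    unfolding line_cycle_def turnaround_activities_def hd_last_nth by auto
  with assms show "e \<in> line_events L" "f \<in> line_events L" by auto
qed

text \<open>Positions follow the traversal of the line cycle; only the turnaround at the first stop
  wraps around, from \<open>4 * (length L - 1) - 1\<close> to 0.\<close>

lemma event_pos_activity:
  assumes "(e, f) \<in> parcs (line_cycle L)"
  shows "event_pos L f = Suc (event_pos L e) mod (4 * (length L - 1))"
proof -
  consider (drive) "(e, f) \<in> driving_activities L" | (wait) "(e, f) \<in> waiting_activities L"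
    | (turn) "(e, f) \<in> turnaround_activities L"
    using assms by (auto simp: line_cycle_def)
  then show ?thesis
  proof cases
    case drive
    then obtain i where i: "Suc i < length L"
      and "e = (L ! i, L, Dep, Fwd) \<and> f = (L ! Suc i, L, Arr, Fwd) \<or>
        e = (L ! Suc i, L, Dep, Bwd) \<and> f = (L ! i, L, Arr, Bwd)"
      unfolding driving_activities_def by blast
    then show ?thesis
      by (auto simp: event_pos_nth simp del: event_pos.simps)
  next
    case wait
    then obtain v s where ef: "e = (v, L, Arr, s)" "f = (v, L, Dep, s)"
      and in_events: "e \<in> line_events L" "f \<in> line_events L"
      unfolding waiting_activities_def by blast
    from in_events(1) ef(1) obtain j where v: "v = L ! j" "j < length L"
      by (auto elim!: line_event_cases)
    \<comment> \<open>The new position stays below the modulus, so \<open>mod\<close> has no effect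
      on waiting activities.\<close>
    have "event_pos L f < 4 * (length L - 1)" using in_events(2) by (rule event_pos_less)
    moreover have "event_pos L f = Suc (event_pos L e)"
    proof (cases s)
      case Fwd
      with ef in_events v dist have "j > 0"
        by (auto elim!: line_event_cases simp: nth_eq_iff_index_eq)
      then show ?thesis using ef v Fwd by (simp add: event_pos_nth del: event_pos.simps)
    next
      case Bwd
      then show ?thesis using ef v two_stops
        by (simp add: event_pos_nth del: event_pos.simps)
    qed
    ultimately show ?thesis by simp
  next
    case turn
    then have "e = (L ! 0, L, Arr, Bwd) \<and> f = (L ! 0, L, Dep, Fwd) \<or>
      e = (L ! (length L - 1), L, Arr, Fwd) \<and> f = (L ! (length L - 1), L, Dep, Bwd)"
      unfolding turnaround_activities_def hd_last_nth by blast
    moreover have "0 < length L" "length L - 1 < length L" using nonempty by simp_all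
    note pos = this[THEN event_pos_nth(1)] this[THEN event_pos_nth(2)]
      this[THEN event_pos_nth(3)] this[THEN event_pos_nth(4)]
    ultimately show ?thesis using two_stops
      by (elim disjE conjE) (simp_all only: pos, simp_all)
  qed
qed

end

section \<open>The expanded line cycle as a layered graph\<close>

text \<open>Built from the activities of \<open>L\<close> alone rather than by restricting the whole
  network, so that each arc visibly comes from the line cycle.\<close>

definition expanded_cycle ::
  "nat \<Rightarrow> ('v activity \<Rightarrow> int) \<Rightarrow> ('v activity \<Rightarrow> int) \<Rightarrow> 'v line \<Rightarrow> 'v xevent pair_pre_digraph" where
  "expanded_cycle T l u L = \<lparr> pverts = line_events L \<times> {..<T},
     parcs = (\<Union>\<alpha>\<in>parcs (line_cycle L). expanded_arcs T l u \<alpha>) \<rparr>"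

lemma line_of_event: "e \<in> line_events L \<Longrightarrow> fst (snd e) = L"
  by (auto simp: line_events_def)

text \<open>Events carry their line, so a transfer never joins two events of the same line.\<close>

lemma event_network_activity_within_line:
  assumes "(e, f) \<in> parcs (event_network \<L>)" "e \<in> line_events L" "f \<in> line_events L"
  shows "(e, f) \<in> parcs (line_cycle L)"
proof -
  have lines: "fst (snd e) = L" "fst (snd f) = L" using assms line_of_event by blast+
  then have "(e, f) \<notin> transfer_activities \<L>" by (auto simp: transfer_activities_def)
  then obtain M where M: "(e, f) \<in> parcs (line_cycle M)"
    using assms(1) by (auto simp: event_network_def)
  then have "fst (snd e) = M"
    by (auto simp: line_cycle_def driving_activities_def waiting_activities_def
        turnaround_activities_def)
  with M lines show ?thesis by simp
qed

text \<open>Restriction to the nodes of \<open>L\<close> keeps no foreign arcs by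
  \<open>event_network_activity_within_line\<close>, and loses none since the activities of
  \<open>L\<close> have both ends among its events.\<close>

lemma expanded_line_cycle_eq:
  assumes "L \<in> \<L>" "distinct L" "length L \<ge> 2"
  shows "expanded_line_cycle \<L> T l u L = with_proj (expanded_cycle T l u L)"
proof -
  have "parcs (line_cycle L) \<subseteq> parcs (event_network \<L>)"
    using assms(1) by (auto simp: event_network_def)
  moreover have ends: "fst a \<in> {e} \<times> {..<T}" "snd a \<in> {f} \<times> {..<T}"
    if "a \<in> expanded_arcs T l u (e, f)" for a e f
    using that by (auto simp: expanded_arcs_def)
  ultimately have "a \<in> parcs (expanded_cycle T l u L) \<longleftrightarrow> a \<in> parcs (expanded_network \<L> T l u) \<and>
      fst a \<in> line_events L \<times> {..<T} \<and> snd a \<in> line_events L \<times> {..<T}" (is "?l \<longleftrightarrow> ?r") for a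
  proof (intro iffI)
    assume ?l
    then obtain e f where "(e, f) \<in> parcs (line_cycle L)" "a \<in> expanded_arcs T l u (e, f)"
      by (auto simp: expanded_cycle_def)
    with ends[of a e f] line_cycle_activity_ends[OF assms(2,3), of e f]
      \<open>parcs (line_cycle L) \<subseteq> parcs (event_network \<L>)\<close>
    show ?r by (auto simp: expanded_network_def)
  next
    assume r: ?r
    then obtain e f where ef: "(e, f) \<in> parcs (event_network \<L>)" "a \<in> expanded_arcs T l u (e, f)"
      by (auto simp: expanded_network_def)
    then have "(e, f) \<in> parcs (line_cycle L)"
      using r ends[of a e f] by (intro event_network_activity_within_line) auto
    with ef show ?l by (auto simp: expanded_cycle_def)
  qed
  then have "{a \<in> parcs (expanded_network \<L> T l u). fst a \<in> line_events L \<times> {..<T} \<and>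
      snd a \<in> line_events L \<times> {..<T}} = parcs (expanded_cycle T l u L)"
    by (intro set_eqI) (simp only: mem_Collect_eq)
  then show ?thesis
    by (simp add: expanded_line_cycle_def induce_subgraph_def with_proj_def line_cycle_def)
       (simp add: expanded_cycle_def)
qed

lemma cyclic_layering_expanded_cycle:
  assumes "distinct L" "length L \<ge> 2"
  shows "cyclic_layering (expanded_cycle T l u L) (event_pos L \<circ> fst) (4 * (length L - 1))"
proof
  have "finite (line_events L)"
    using card_line_events[OF assms] assms(2) by (intro card_ge_0_finite) simp
  then show "finite (pverts (expanded_cycle T l u L))" by (simp add: expanded_cycle_def)
  show "parcs (expanded_cycle T l u L)
      \<subseteq> pverts (expanded_cycle T l u L) \<times> pverts (expanded_cycle T l u L)"
    using line_cycle_activity_ends[OF assms]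
    by (auto simp: expanded_cycle_def expanded_arcs_def)
  show "(event_pos L \<circ> fst) v < 4 * (length L - 1)" if "v \<in> pverts (expanded_cycle T l u L)" for v
    using that event_pos_less[OF assms] by (auto simp: expanded_cycle_def)
  show "(event_pos L \<circ> fst) w = Suc ((event_pos L \<circ> fst) v) mod (4 * (length L - 1))"
    if "(v, w) \<in> parcs (expanded_cycle T l u L)" for v w
    using that event_pos_activity[OF assms] by (auto simp: expanded_cycle_def expanded_arcs_def)
qed

text \<open>Merges both dual sums into one node weight, the shape that \<open>awalk_cost_cut\<close>
  expects.\<close>

lemma pricing_objective_eq:
  "pricing_objective \<L> T l \<omega> \<nu> \<rho> c =
    (\<Sum>a\<in>c. real_of_rat (\<omega> (activity_of a)) * real_of_int (duration T l a)) -
    (\<Sum>x\<in>fst ` c \<union> snd ` c. (\<Sum>y\<in>{y. (fst x, y) \<in> transfer_activities \<L>}. \<nu> x y) +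
       (\<Sum>y\<in>{y. (y, fst x) \<in> transfer_activities \<L>}. \<rho> y x))"
  by (simp add: pricing_objective_def cycle_cost_def coupling_dual_sum_def cycle_verts_def
      sum.distrib)

section \<open>Pricing as \<open>T\<close> shortest path problems\<close>

text \<open>One graph with fixed ends serves all dual values; only the weights \<open>w\<close>
  change with them. Infima in \<open>ereal\<close> also cover a line without cycles, whose optimal
  value is infinite.\<close>

theorem lemma5p22:
  fixes G :: "'v pair_pre_digraph" and \<L> :: "'v line set" and T :: nat
    and l u :: "'v activity \<Rightarrow> int" and \<omega> :: "'v activity \<Rightarrow> rat" and L :: "'v line"
  assumes "line_network G \<L>"
    and "T > 0"
    and "\<forall>\<alpha>\<in>parcs (event_network \<L>). l \<alpha> \<le> u \<alpha>"
    and "L \<in> \<L>"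
  shows "\<exists>(H :: ('v xevent \<times> bool) pair_pre_digraph) src tgt.
    fin_digraph (with_proj H) \<and> acyclic (parcs H) \<and>
    node_splitting (expanded_line_cycle \<L> T l u L) H \<and>
    src ` {..<T} \<subseteq> pverts H \<and> inj_on src {..<T} \<and>
    tgt ` {..<T} \<subseteq> pverts H \<and> inj_on tgt {..<T} \<and>
    bij_betw (\<lambda>(t, p). unsplit_path p)
      (SIGMA t:{..<T}. {p. pre_digraph.apath (with_proj H) (src t) p (tgt t)})
      (cycles_of_line \<L> T l u L) \<and>
    (\<forall>\<mu> \<nu> \<rho>. \<exists>w :: ('v xevent \<times> bool) \<times> ('v xevent \<times> bool) \<Rightarrow> real.
      (\<forall>t<T. \<forall>p. pre_digraph.apath (with_proj H) (src t) p (tgt t) \<longrightarrow>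
         pricing_objective \<L> T l \<omega> \<nu> \<rho> (unsplit_path p) = wf_digraph.awalk_cost w p) \<and>
      (INF c\<in>cycles_of_line \<L> T l u L. ereal (pricing_objective \<L> T l \<omega> \<nu> \<rho> c))
        = (INF t\<in>{..<T}. wf_digraph.\<mu> (with_proj H) w (src t) (tgt t)) \<and>
      ((\<exists>c\<in>cycles_of_line \<L> T l u L. \<not> dual_constraint \<L> T l \<omega> \<mu> \<nu> \<rho> L c) \<longleftrightarrow>
         (\<exists>t<T. wf_digraph.\<mu> (with_proj H) w (src t) (tgt t) < ereal (\<mu> L))))"
proof -
  have L: "distinct L" "length L \<ge> 2"
    using assms(1,4) by (auto simp: line_network_def vpath_def)
  let ?X = "expanded_cycle T l u L"
  interpret cyclic_layering ?X "event_pos L \<circ> fst" "4 * (length L - 1)"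
    using cyclic_layering_expanded_cycle[OF L] .
  note graph_eq = expanded_line_cycle_eq[OF assms(4) L, of T l u]
  let ?C = "cycles_of_line \<L> T l u L"
  have cycles: "?C = winding_once"
  proof -
    have "card (cycle_verts (set p)) = length p" if "X.cycle p" for p
      using X.card_cycle_verts[OF that] by (simp add: cycle_verts_def)
    then show ?thesis
      unfolding cycles_of_line_def winding_once_def graph_eq
      using card_line_events[OF L] by (auto simp: line_cycle_def)
  qed
  define \<sigma> where "\<sigma> t = ((hd L, L, Dep, Fwd), t)" for t :: nat
  have \<sigma>: "bij_betw \<sigma> {..<T} {v \<in> pverts ?X. (event_pos L \<circ> fst) v = 0}"
    using event_pos_eq_0[OF L] first_event_in[OF L]
    by (auto simp: bij_betw_def inj_on_def \<sigma>_def expanded_cycle_def simp del: event_pos.simps)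
  let ?src = "\<lambda>t. (\<sigma> t, False)" and ?tgt = "\<lambda>t. (\<sigma> t, True)"
  have bij: "bij_betw (\<lambda>(t, p). unsplit_path p)
      (SIGMA t:{..<T}. {p. H.apath (?src t) p (?tgt t)}) ?C"
    using bij_betw_apaths_winding_once[OF \<sigma>] unfolding cycles unsplit_path_def .
  have \<sigma>_in: "\<sigma> ` {..<T} = {v \<in> pverts ?X. (event_pos L \<circ> fst) v = 0}" and "inj_on \<sigma> {..<T}"
    using \<sigma> by (auto simp: bij_betw_def)
  then have "\<sigma> t \<in> pverts ?X \<and> (event_pos L \<circ> fst) (\<sigma> t) = 0" if "t < T" for t
    using that by blast
  with \<open>inj_on \<sigma> {..<T}\<close> have ends: "?src ` {..<T} \<subseteq> pverts cut" "inj_on ?src {..<T}"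
    "?tgt ` {..<T} \<subseteq> pverts cut" "inj_on ?tgt {..<T}"
    by (auto simp: cut_def inj_on_def)
  have weights: "\<exists>w.
      (\<forall>t<T. \<forall>p. H.apath (?src t) p (?tgt t) \<longrightarrow>
         pricing_objective \<L> T l \<omega> \<nu> \<rho> (unsplit_path p) = H.awalk_cost w p) \<and>
      (INF c\<in>?C. ereal (pricing_objective \<L> T l \<omega> \<nu> \<rho> c))
        = (INF t\<in>{..<T}. H.\<mu> w (?src t) (?tgt t)) \<and>
      ((\<exists>c\<in>?C. \<not> dual_constraint \<L> T l \<omega> \<mu> \<nu> \<rho> L c) \<longleftrightarrow>
         (\<exists>t<T. H.\<mu> w (?src t) (?tgt t) < ereal (\<mu> L)))"
    for \<mu> :: "'v line \<Rightarrow> real" and \<nu> :: "'v xevent \<Rightarrow> 'v event \<Rightarrow> real"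
      and \<rho> :: "'v event \<Rightarrow> 'v xevent \<Rightarrow> real"
  proof -
    let ?obj = "pricing_objective \<L> T l \<omega> \<nu> \<rho>"
    \<comment> \<open>Arc cost minus the dual sums at the tail: a path from a source copy to its
      target copy has each node of the cycle as a tail exactly once.\<close>
    define w where "w e =
      real_of_rat (\<omega> (activity_of (map_prod fst fst e)))
        * real_of_int (duration T l (map_prod fst fst e)) -
      ((\<Sum>y\<in>{y. (fst (fst (fst e)), y) \<in> transfer_activities \<L>}. \<nu> (fst (fst e)) y) +
       (\<Sum>y\<in>{y. (y, fst (fst (fst e))) \<in> transfer_activities \<L>}. \<rho> y (fst (fst e))))"
      for e :: "('v xevent \<times> bool) \<times> ('v xevent \<times> bool)"
    have cost: "?obj (unsplit_path p) = H.awalk_cost w p" if "H.apath (?src t) p (?tgt t)" for t p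
      unfolding pricing_objective_eq w_def
      using awalk_cost_cut[OF that unsplit_path_def] by (rule sym)
    define P where "P = (SIGMA t:{..<T}. {p. H.apath (?src t) p (?tgt t)})"
    have C: "?C = (\<lambda>(t, p). unsplit_path p) ` P"
      using bij by (simp add: bij_betw_def P_def)
    have inf_obj: "(INF c\<in>?C. ereal (?obj c)) = (INF (t, p)\<in>P. ereal (H.awalk_cost w p))"
      unfolding C image_image by (intro INF_cong) (auto simp: P_def cost)
    \<comment> \<open>The infimum over pairs \<open>(t, p)\<close> splits into one distance for each
      \<open>t\<close>.\<close>
    have inf_\<mu>: "(INF (t, p)\<in>P. ereal (H.awalk_cost w p)) =
        (INF t\<in>{..<T}. H.\<mu> w (?src t) (?tgt t))"
      unfolding \<mu>_cut_eq P_def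
      by (intro antisym INF_greatest) (auto intro: INF_lower2)
    have "\<not> dual_constraint \<L> T l \<omega> \<mu> \<nu> \<rho> L c \<longleftrightarrow> ereal (?obj c) < ereal (\<mu> L)" for c
      by (auto simp: dual_constraint_def pricing_objective_def)
    \<comment> \<open>An infimum in \<open>ereal\<close> lies below \<open>\<mu> L\<close> iff some
      member does; for empty \<open>?C\<close> it is infinite and both sides fail.\<close>
    then have "(\<exists>c\<in>?C. \<not> dual_constraint \<L> T l \<omega> \<mu> \<nu> \<rho> L c) \<longleftrightarrow>
        (INF c\<in>?C. ereal (?obj c)) < ereal (\<mu> L)"
      by (simp add: INF_less_iff)
    also have "\<dots> \<longleftrightarrow> (\<exists>t<T. H.\<mu> w (?src t) (?tgt t) < ereal (\<mu> L))"
      unfolding inf_obj inf_\<mu> by (auto simp: INF_less_iff)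
    finally show ?thesis
      using cost inf_obj inf_\<mu> by (intro exI[of _ w]) simp
  qed
  show ?thesis
    unfolding graph_eq
    using H.fin_digraph_axioms acyclic_cut node_splitting_cut ends bij weights
    by (intro exI[of _ cut] exI[of _ ?src] exI[of _ ?tgt]) (simp add: graph_eq)
qed

end
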